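(* We have \[ \sum_{k=1}^{\infty} \sum_{j=k}^{\infty} \frac{(-1)^{k-1}}{k^{2}} \, \frac{1}{j \, 2^{j}} = \frac{13}{24}\, \zeta(3). \]
   Context: $\zeta$ denotes the Riemann zeta function, so $\zeta(3) = \sum_{n=1}^\infty 1/n^3$. *)

theory Defs
  imports Complex_Main
begin

(* The Riemann zeta function on the real half-line s > 1, by its Dirichlet series; the index is
   shifted so that n runs over the positive integers Suc n.  The analytic continuation is not
   covered: the series diverges for s <= 1, and the value given there is meaningless. *)
definition zeta :: "real \<Rightarrow> real" where
  "zeta s = (\<Sum>n. 1 / real (Suc n) powr s)"

(* The inner sum over j from k to infinity is indexed by i = j - k in the uses of this summand;
   it is only meant for 1 <= k <= j. *)
definition summand :: "nat \<Rightarrow> nat \<Rightarrow> real" where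
  "summand k j = ((-1) ^ (k - 1) / real k ^ 2) * (1 / (real j * 2 ^ j))"

end

(* Write L_s for the polylogarithm. Differentiating in x turns the double sum with 1/2 replaced
   by x into the primitive of - L_2(-x) / (x (1 - x)). Integration by parts leaves
   ln(1 - x) ln(1 + x) / x, which is split as ((a + b)^2 - (a - b)^2) / 4 with a = ln(1 - x) and
   b = ln(1 + x). Squares of logarithms integrate to L_3 through the single primitive
   L_3(y) - ln|y| L_2(y) - ln^2|y| ln(1 - y) / 2 of ln^2|y| / (2 (1 - y)), so the sum at x = 1/2
   becomes a combination of L_3 at -1/2, 3/4, 1/3, -1/3. It collapses to a multiple of L_3(1) by
   Landen's identity at 1/2, 2/3, 3/4, duplication at 1/2 and 1, and Kummer's identity at 1/2;
   the latter is just (a + b)^2 + (a - b)^2 = 2 a^2 + 2 b^2 integrated. *)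

theory Submission
  imports Defs "HOL-Analysis.Analysis" "HOL-Real_Asymp.Real_Asymp"
begin

section \<open>Polylogarithm series: continuity, derivatives, duplication\<close>

text \<open>For \<open>s > 0\<close> the term with \<open>n = 0\<close> is \<open>1 / 0 = 0\<close>.\<close>

definition polylog :: "nat \<Rightarrow> real \<Rightarrow> real" where
  "polylog s x = (\<Sum>n. x ^ n / real n ^ s)"

lemma polylog_0 [simp]: "s > 0 \<Longrightarrow> polylog s 0 = 0"
proof -
  assume "s > 0"
  hence "(\<lambda>n. (0::real) ^ n / real n ^ s) = (\<lambda>n. 0)"
    by (auto simp: fun_eq_iff power_0_left)
  thus ?thesis by (simp add: polylog_def)
qed

lemma polylog_summand_le:
  assumes "\<bar>x\<bar> \<le> 1"
  shows "norm (x ^ n / real n ^ s) \<le> 1 / real n ^ s"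
  using assms by (simp add: power_abs divide_right_mono power_le_one)

lemma summable_polylog:
  assumes "s \<ge> 2" "\<bar>x\<bar> \<le> 1"
  shows "summable (\<lambda>n. x ^ n / real n ^ s)"
proof (rule summable_comparison_test')
  show "summable (\<lambda>n. 1 / real n ^ s)"
    using inverse_power_summable[OF assms(1), where 'a = real] by (simp add: field_simps)
qed (use polylog_summand_le[OF assms(2)] in auto)

text \<open>For \<open>s >= 2\<close> the majorant \<open>1 / n ^ s\<close> is summable, so
  convergence is uniform up to the endpoints. Both are needed: constants of integration involve
  values at 1 and -1.\<close>

lemma continuous_on_polylog:
  assumes "s \<ge> 2"
  shows "continuous_on {-1..1} (polylog s)"
proof -
  have "uniform_limit {-1..1} (\<lambda>N x. \<Sum>n<N. x ^ n / real n ^ s)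
          (\<lambda>x. \<Sum>n. x ^ n / real n ^ s) sequentially"
    by (rule Weierstrass_m_test[where M = "\<lambda>n. 1 / real n ^ s"])
       (use polylog_summand_le summable_polylog[OF assms, of 1] in \<open>auto simp: abs_le_iff\<close>)
  hence "continuous_on {-1..1} (\<lambda>x. \<Sum>n. x ^ n / real n ^ s)"
    by (rule uniform_limit_theorem[rotated])
       (auto intro!: continuous_intros always_eventually simp: divide_inverse)
  thus ?thesis by (simp add: polylog_def[abs_def])
qed

lemmas continuous_on_polylog_compose [continuous_intros] =
  continuous_on_compose2[OF continuous_on_polylog]

lemma summable_power_over_power:
  assumes "\<bar>x\<bar> < 1"
  shows "summable (\<lambda>n. x ^ n / real n ^ s)"
proof (rule summable_comparison_test')
  show "summable (\<lambda>n. \<bar>x\<bar> ^ n)" using assms by (simp add: summable_geometric)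
  show "norm (x ^ n / real n ^ s) \<le> \<bar>x\<bar> ^ n" if "n \<ge> 1" for n
    using that mult_left_mono[of 1 "real n ^ s" "\<bar>x\<bar> ^ n"]
    by (simp add: power_abs field_simps)
qed

text \<open>Termwise differentiation cancels one power of \<open>n\<close> and lowers the exponent
  of \<open>x\<close> by one, whence the division by \<open>x\<close>. With \<open>s > 0\<close> the
  term at \<open>n = 0\<close> of \<open>polylog s x\<close> vanishes, so the index shift loses
  nothing.\<close>

lemma has_real_derivative_polylog:
  assumes "\<bar>x\<bar> < 1" "x \<noteq> 0" "s > 0"
  shows "(polylog (Suc s) has_real_derivative polylog s x / x) (at x)"
proof -
  let ?c = "\<lambda>n. 1 / real n ^ Suc s"
  have "((\<lambda>x. \<Sum>n. ?c n * x ^ n) has_real_derivative (\<Sum>n. diffs ?c n * x ^ n)) (at x)"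
    using summable_power_over_power[of _ "Suc s"] assms(1)
    by (intro termdiffs_strong'[where K = 1]) (simp_all add: field_simps)
  also have "(\<lambda>x. \<Sum>n. ?c n * x ^ n) = polylog (Suc s)"
    by (simp add: polylog_def fun_eq_iff)
  also have "(\<lambda>n. diffs ?c n * x ^ n) = (\<lambda>n. (x ^ Suc n / real (Suc n) ^ s) / x)"
    using assms(2) by (auto simp: diffs_def field_simps simp del: of_nat_Suc)
  also have "(\<Sum>n. (x ^ Suc n / real (Suc n) ^ s) / x) = (\<Sum>n. x ^ Suc n / real (Suc n) ^ s) / x"
    using summable_power_over_power[OF assms(1), of s]
    by (intro suminf_divide) (subst summable_Suc_iff)
  also have "(\<Sum>n. x ^ Suc n / real (Suc n) ^ s) = polylog s x"
    using suminf_split_head[OF summable_power_over_power[OF assms(1), of s]] assms(3)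
    by (simp add: polylog_def)
  finally show ?thesis .
qed

lemma polylog_1:
  assumes "\<bar>x\<bar> < 1"
  shows "polylog 1 x = - ln (1 - x)"
proof -
  have "ln (1 - x) = (\<Sum>n. (-1) ^ n * (1 / real (n + 1)) * (- x) ^ Suc n)"
    using ln_series[of "1 - x"] assms by simp
  also have "\<dots> = (\<Sum>n. - (x ^ Suc n / real (Suc n) ^ 1))"
  proof (rule suminf_cong)
    fix n
    have "(-1) ^ n * (- x) ^ n = x ^ n"
      by (simp flip: power_mult_distrib)
    thus "(-1) ^ n * (1 / real (n + 1)) * (- x) ^ Suc n = - (x ^ Suc n / real (Suc n) ^ 1)"
      by (simp add: divide_simps)
  qed
  also have "\<dots> = - (\<Sum>n. x ^ Suc n / real (Suc n) ^ 1)"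
    using summable_power_over_power[OF assms, of 1]
    by (intro suminf_minus) (subst summable_Suc_iff)
  also have "(\<Sum>n. x ^ Suc n / real (Suc n) ^ 1) = polylog 1 x"
    using suminf_split_head[OF summable_power_over_power[OF assms, of 1]]
    by (simp add: polylog_def)
  finally show ?thesis by simp
qed

lemma has_real_derivative_polylog2:
  assumes "\<bar>x\<bar> < 1" "x \<noteq> 0"
  shows "(polylog 2 has_real_derivative - ln (1 - x) / x) (at x)"
  using has_real_derivative_polylog[OF assms, of 1] polylog_1[OF assms(1)]
  by (simp add: numeral_2_eq_2)

lemma has_real_derivative_polylog3:
  assumes "\<bar>x\<bar> < 1" "x \<noteq> 0"
  shows "(polylog 3 has_real_derivative polylog 2 x / x) (at x)"
  using has_real_derivative_polylog[OF assms, of 2] by (simp add: eval_nat_numeral)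

lemmas polylog_derivs [derivative_intros] =
  has_real_derivative_polylog2[THEN DERIV_chain2]
  has_real_derivative_polylog3[THEN DERIV_chain2]

text \<open>In the sum of the series at \<open>x\<close> and \<open>- x\<close> the odd terms
  cancel, and the term at \<open>2 * n\<close> is \<open>2 / 2 ^ s\<close> times the term of the
  series at \<open>x\<^sup>2\<close>.\<close>

lemma polylog_square:
  assumes "s \<ge> 2" "\<bar>x\<bar> \<le> 1"
  shows "polylog s (x\<^sup>2) = 2 ^ (s - 1) * (polylog s x + polylog s (- x))"
proof -
  let ?f = "\<lambda>n. x ^ n / real n ^ s + (- x) ^ n / real n ^ s"
  have sums: "?f sums (polylog s x + polylog s (- x))"
    unfolding polylog_def
    by (intro sums_add summable_sums summable_polylog) (use assms in auto)
  have "(\<lambda>n. ?f (n * 2)) sums (polylog s x + polylog s (- x))"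
    using sums
  proof (subst sums_mono_reindex)
    show "strict_mono (\<lambda>n::nat. n * 2)" by (auto simp: strict_mono_def)
    fix n :: nat assume "n \<notin> range (\<lambda>n. n * 2)"
    hence "odd n" by (auto elim!: evenE simp: mult.commute)
    thus "?f n = 0" by simp
  qed
  from sums_mult[OF this, of "2 ^ (s - 1)"]
  have "(\<lambda>n. 2 ^ (s - 1) * ?f (n * 2)) sums (2 ^ (s - 1) * (polylog s x + polylog s (- x)))" .
  also have "(\<lambda>n. 2 ^ (s - 1) * ?f (n * 2)) = (\<lambda>n. (x\<^sup>2) ^ n / real n ^ s)"
  proof
    fix n
    have "(2::real) ^ s = 2 * 2 ^ (s - 1)"
      using assms(1) by (cases s) auto
    thus "2 ^ (s - 1) * ?f (n * 2) = (x\<^sup>2) ^ n / real n ^ s"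
      by (simp add: power_mult_distrib mult.commute[of n] flip: power_mult)
  qed
  finally show ?thesis by (simp add: polylog_def sums_iff)
qed

lemma polylog_minus_1: "polylog 3 (-1) = - 3 / 4 * polylog 3 1"
  using polylog_square[of 3 1] by simp

section \<open>Functional equations of L_2 and L_3\<close>

lemma tendsto_ln_mult_ln_one_minus:
  "((\<lambda>x::real. ln x * ln (1 - x)) \<longlongrightarrow> 0) (at_left 1)"
  by real_asymp

text \<open>The end 1 is included: since \<open>ln 1 = 0\<close>, the value of the product there is
  0, which is also its limit from the left. Identities can thus be anchored at 1 without a separate
  limit argument.\<close>

lemma continuous_on_ln_mult_ln_one_minus:
  "continuous_on {0<..1} (\<lambda>x::real. ln x * ln (1 - x))"
proof (subst continuous_on_eq_continuous_within, rule ballI)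
  fix y :: real assume y: "y \<in> {0<..1}"
  show "continuous (at y within {0<..1}) (\<lambda>x::real. ln x * ln (1 - x))"
  proof (cases "y = 1")
    case True
    have "((\<lambda>x::real. ln x * ln (1 - x)) \<longlongrightarrow> 0) (at 1 within {0<..1})"
      by (rule tendsto_mono[OF _ tendsto_ln_mult_ln_one_minus],
          unfold at_within_def, rule inf_mono) auto
    thus ?thesis using True by (simp add: continuous_within)
  next
    case False
    thus ?thesis using y by (auto intro!: continuous_intros)
  qed
qed

lemma continuous_on_ln_mult_ln_one_minus_compose [continuous_intros]:
  fixes f :: "'a::topological_space \<Rightarrow> real"
  assumes "continuous_on A f" "\<And>x. x \<in> A \<Longrightarrow> 0 < f x" "\<And>x. x \<in> A \<Longrightarrow> f x \<le> 1"
  shows "continuous_on A (\<lambda>x. ln (f x) * ln (1 - f x))"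
  by (rule continuous_on_compose2[OF continuous_on_ln_mult_ln_one_minus assms(1)])
     (use assms in auto)

text \<open>The derivative of the product of logarithms cancels those of the two dilogarithms. The
  constant is read off at 1, where only L_2(1) survives.\<close>

lemma dilog_reflection:
  assumes "0 < x" "x < 1"
  shows "polylog 2 x + polylog 2 (1 - x) + ln x * ln (1 - x) = polylog 2 1"
proof -
  let ?f = "\<lambda>x. polylog 2 x + polylog 2 (1 - x) + ln x * ln (1 - x)"
  have "?f 1 = ?f x"
  proof (rule DERIV_isconst_end[OF assms(2)])
    show "continuous_on {x..1} ?f"
      by (intro continuous_intros) (use assms in auto)
    show "(?f has_real_derivative 0) (at y)" if "x < y" "y < 1" for y
      using that assms by (auto intro!: derivative_eq_intros simp: divide_simps)
  qed
  thus ?thesis by simp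
qed

text \<open>For u = 1 - 1/y one has u'/u = 1/(y (y - 1)), and the lower bound on \<open>y\<close> is
  what keeps u above -1. The numerator of the first derivative is -ln(1 - u) = ln y.\<close>

lemma polylog_one_minus_inverse_derivs:
  assumes "1 / 2 < y" "y < 1"
  shows "((\<lambda>x. polylog 2 (1 - 1 / x)) has_real_derivative ln y / (y * (y - 1))) (at y)"
    and "((\<lambda>x. polylog 3 (1 - 1 / x)) has_real_derivative
            polylog 2 (1 - 1 / y) / (y * (y - 1))) (at y)"
proof -
  have u: "((\<lambda>x. 1 - 1 / x) has_real_derivative 1 / y\<^sup>2) (at y)"
    using assms by (auto intro!: derivative_eq_intros simp: power2_eq_square)
  have y: "\<bar>1 - 1 / y\<bar> < 1" "1 - 1 / y \<noteq> 0"
    using assms by (auto simp: abs_if field_simps)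
  have e: "1 / (1 - 1 / y) * (1 / y\<^sup>2) = 1 / (y * (y - 1))"
    using assms by (simp add: divide_simps power2_eq_square)
  have e': "c / (1 - 1 / y) * (1 / y\<^sup>2) = c / (y * (y - 1))" for c
    using arg_cong[OF e, of "\<lambda>z. c * z"] by simp
  have "((\<lambda>x. polylog 2 (1 - 1 / x)) has_real_derivative
          - ln (1 - (1 - 1 / y)) / (1 - 1 / y) * (1 / y\<^sup>2)) (at y)"
    by (rule DERIV_chain2[OF has_real_derivative_polylog2[OF y] u])
  thus "((\<lambda>x. polylog 2 (1 - 1 / x)) has_real_derivative ln y / (y * (y - 1))) (at y)"
    unfolding e' using assms by (simp add: ln_div)
  have "((\<lambda>x. polylog 3 (1 - 1 / x)) has_real_derivative
          polylog 2 (1 - 1 / y) / (1 - 1 / y) * (1 / y\<^sup>2)) (at y)"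
    by (rule DERIV_chain2[OF has_real_derivative_polylog3[OF y] u])
  thus "((\<lambda>x. polylog 3 (1 - 1 / x)) has_real_derivative
            polylog 2 (1 - 1 / y) / (y * (y - 1))) (at y)"
    unfolding e' .
qed

text \<open>The derivatives cancel because 1/(1 - y) + 1/(y (y - 1)) + 1/y = 0. At 1 both arguments
  of L_2 are 0, so the constant is 0.\<close>

lemma dilog_landen:
  assumes "1 / 2 \<le> x" "x < 1"
  shows "polylog 2 (1 - x) + polylog 2 (1 - 1 / x) = - (ln x)\<^sup>2 / 2"
proof -
  let ?f = "\<lambda>x. polylog 2 (1 - x) + polylog 2 (1 - 1 / x) + (ln x)\<^sup>2 / 2"
  have "?f 1 = ?f x"
  proof (rule DERIV_isconst_end[OF assms(2)])
    show "continuous_on {x..1} ?f"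
      by (intro continuous_intros) (use assms in \<open>auto simp: field_simps\<close>)
    show "(?f has_real_derivative 0) (at y)" if "x < y" "y < 1" for y
    proof -
      have y: "1 / 2 < y" "y < 1" using that assms by auto
      have d: "((\<lambda>x. polylog 2 (1 - x)) has_real_derivative ln y / (1 - y)) (at y)"
              "((\<lambda>x. (ln x)\<^sup>2 / 2) has_real_derivative ln y / y) (at y)"
        using y by (auto intro!: derivative_eq_intros)
      have "ln y / (1 - y) + ln y / (y * (y - 1)) + ln y / y = 0"
        using y by (simp add: divide_simps) (simp add: algebra_simps)
      with DERIV_add[OF DERIV_add[OF d(1) polylog_one_minus_inverse_derivs(1)[OF y]] d(2)]
      show ?thesis by simp
    qed
  qed
  thus ?thesis by (simp add: algebra_simps)
qed

text \<open>Differentiation brings in L_2 at y, 1 - y and 1 - 1/y. Landen's identity for L_2 removes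
  the last, and reflection expands the constant L_2(1), after which everything cancels. At 1 only
  L_3(1) is left.\<close>

lemma trilog_landen:
  assumes "1 / 2 \<le> x" "x < 1"
  shows "polylog 3 x + polylog 3 (1 - x) + polylog 3 (1 - 1 / x) =
           polylog 3 1 + (ln x) ^ 3 / 6 + polylog 2 1 * ln x - (ln x)\<^sup>2 * ln (1 - x) / 2"
proof -
  \<comment> \<open>The square of \<open>ln x\<close> is split as a nested product so that
    continuity of \<open>ln x * ln (1 - x)\<close> up to 1 applies.\<close>
  let ?f = "\<lambda>x. polylog 3 x + polylog 3 (1 - x) + polylog 3 (1 - 1 / x)
              - (ln x) ^ 3 / 6 - polylog 2 1 * ln x + ln x * (ln x * ln (1 - x)) / 2"
  have "?f 1 = ?f x"
  proof (rule DERIV_isconst_end[OF assms(2)])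
    show "continuous_on {x..1} ?f"
      by (intro continuous_intros) (use assms in \<open>auto simp: field_simps\<close>)
    show "(?f has_real_derivative 0) (at y)" if y: "x < y" "y < 1" for y
    proof -
      have y': "1 / 2 < y" "y < 1" using y assms by auto
      have *: "polylog 2 1 = polylog 2 y + polylog 2 (1 - y) + ln y * ln (1 - y)"
              "polylog 2 (1 - 1 / y) = - (ln y)\<^sup>2 / 2 - polylog 2 (1 - y)"
        using dilog_reflection[of y] dilog_landen[of y] y' by auto
      let ?D1 = "polylog 2 y / y - polylog 2 (1 - y) / (1 - y)"
      let ?D2 = "(ln y)\<^sup>2 / (2 * y) + polylog 2 1 / y"
      let ?D3 = "ln y * ln (1 - y) / y - (ln y)\<^sup>2 / (2 * (1 - y))"
      have d: "((\<lambda>x. polylog 3 x + polylog 3 (1 - x)) has_real_derivative ?D1) (at y)"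
              "((\<lambda>x. (ln x) ^ 3 / 6 + polylog 2 1 * ln x) has_real_derivative ?D2) (at y)"
              "((\<lambda>x. ln x * (ln x * ln (1 - x)) / 2) has_real_derivative ?D3) (at y)"
      proof -
        show "((\<lambda>x. polylog 3 x + polylog 3 (1 - x)) has_real_derivative ?D1) (at y)"
          using y' by (auto intro!: derivative_eq_intros)
        have l: "(ln has_real_derivative 1 / y) (at y)"
          using y' by (intro DERIV_ln_divide) auto
        have l': "((\<lambda>x. ln (1 - x)) has_real_derivative - 1 / (1 - y)) (at y)"
          using y' by (auto intro!: derivative_eq_intros)
        show "((\<lambda>x. (ln x) ^ 3 / 6 + polylog 2 1 * ln x) has_real_derivative ?D2) (at y)"
          by (rule DERIV_cong[OF DERIV_add[OF DERIV_cdivide[OF DERIV_power[OF l]] DERIV_cmult[OF l]]])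
             simp
        show "((\<lambda>x. ln x * (ln x * ln (1 - x)) / 2) has_real_derivative ?D3) (at y)"
          by (rule DERIV_cong[OF DERIV_cdivide[OF DERIV_mult[OF l DERIV_mult[OF l l']]]])
             (use y' in \<open>simp add: divide_simps power2_eq_square; simp add: algebra_simps\<close>)
      qed
      have "?D1 + polylog 2 (1 - 1 / y) / (y * (y - 1)) - ?D2 + ?D3 = 0"
        unfolding * using y' by (simp add: divide_simps) (simp add: algebra_simps power2_eq_square)
      with DERIV_add[OF DERIV_diff[OF DERIV_add[OF d(1)
             polylog_one_minus_inverse_derivs(2)[OF y']] d(2)] d(3)]
      show ?thesis by (simp add: algebra_simps)
    qed
  qed
  thus ?thesis by (simp add: power2_eq_square)
qed

section \<open>Primitives of squared logarithms and Kummer's identity\<close>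

text \<open>Since \<open>ln (- y) = ln y\<close> for the real logarithm of the library, this also covers negative
  arguments; since \<open>ln 0 = 0\<close>, its value at \<open>1\<close> is the limit from the left.\<close>

definition logsq_primitive :: "real \<Rightarrow> real" where
  "logsq_primitive y = polylog 3 y - ln y * polylog 2 y - ln y * (ln y * ln (1 - y)) / 2"

lemma has_real_derivative_ln_nonzero:
  assumes "(x::real) \<noteq> 0"
  shows "(ln has_real_derivative 1 / x) (at x)"
proof (cases "x > 0")
  case False
  have "((\<lambda>x::real. ln (- x)) has_real_derivative 1 / x) (at x)"
    using assms False by (auto intro!: derivative_eq_intros)
  thus ?thesis by (simp add: ln_minus)
qed (rule DERIV_ln_divide)

text \<open>The terms in L_2(y)/y cancel, and so do those in ln y ln(1 - y)/y; what remains comes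
  from differentiating \<open>ln (1 - y)\<close>.\<close>

lemma has_real_derivative_logsq_primitive:
  assumes "\<bar>y\<bar> < 1" "y \<noteq> 0"
  shows "(logsq_primitive has_real_derivative (ln y)\<^sup>2 / (2 * (1 - y))) (at y)"
proof -
  note l = has_real_derivative_ln_nonzero[OF assms(2)]
  have l': "((\<lambda>y. ln (1 - y)) has_real_derivative - 1 / (1 - y)) (at y)"
    using assms by (auto intro!: derivative_eq_intros)
  show ?thesis
    unfolding logsq_primitive_def[abs_def]
    by (rule DERIV_cong[OF DERIV_diff[OF
          DERIV_diff[OF has_real_derivative_polylog3[OF assms]
            DERIV_mult[OF l has_real_derivative_polylog2[OF assms]]]
          DERIV_cdivide[OF DERIV_mult[OF l DERIV_mult[OF l l']]]]])
       (use assms in \<open>simp add: divide_simps power2_eq_square; simp add: algebra_simps\<close>)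
qed

lemmas logsq_primitive_derivs [derivative_intros] =
  has_real_derivative_logsq_primitive[THEN DERIV_chain2]

lemma continuous_on_logsq_primitive:
  fixes f :: "'a::topological_space \<Rightarrow> real"
  assumes "continuous_on A f" "\<And>x. x \<in> A \<Longrightarrow> 0 < f x" "\<And>x. x \<in> A \<Longrightarrow> f x \<le> 1"
  shows "continuous_on A (\<lambda>x. logsq_primitive (f x))"
proof (rule continuous_on_compose2[OF _ assms(1)])
  show "continuous_on {0<..1} logsq_primitive"
    unfolding logsq_primitive_def[abs_def] by (intro continuous_intros) auto
qed (use assms in auto)

lemma continuous_on_logsq_primitive_minus:
  fixes f :: "'a::topological_space \<Rightarrow> real"
  assumes "continuous_on A f" "\<And>x. x \<in> A \<Longrightarrow> 0 < f x" "\<And>x. x \<in> A \<Longrightarrow> f x \<le> 1"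
  shows "continuous_on A (\<lambda>x. logsq_primitive (- f x))"
proof (rule continuous_on_compose2[OF _ assms(1)])
  show "continuous_on {0<..1} (\<lambda>y. logsq_primitive (- y))"
    unfolding logsq_primitive_def[abs_def] ln_minus by (intro continuous_intros) auto
qed (use assms in auto)

lemma logsq_primitive_1: "logsq_primitive 1 = polylog 3 1"
  and logsq_primitive_minus_1: "logsq_primitive (-1) = - 3 / 4 * polylog 3 1"
  by (simp_all add: logsq_primitive_def polylog_minus_1 ln_minus)

text \<open>With a = ln(1 - v) and b = ln(1 + v), these are primitives for (a - b)^2, (a + b)^2, a^2
  and b^2 over v, up to constant factors. In the first, with u = (1 - v)/(1 + v), the difference at
  u and -u combines 1/(1 - u) and 1/(1 + u) into a single pole at v = 0. In the last, 1/(v (1 + v))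
  = 1/v - 1/(1 + v), and the cubed logarithm removes the second part.\<close>

lemma logsq_primitive_compose_derivs:
  assumes "0 < v" "v < 1"
  shows "((\<lambda>v. logsq_primitive ((1 - v) / (1 + v)) - logsq_primitive (- ((1 - v) / (1 + v))))
           has_real_derivative - (ln (1 - v) - ln (1 + v))\<^sup>2 / (2 * v)) (at v)"
    and "((\<lambda>v. logsq_primitive (1 - v\<^sup>2))
           has_real_derivative - (ln (1 - v) + ln (1 + v))\<^sup>2 / v) (at v)"
    and "((\<lambda>v. logsq_primitive (1 - v)) has_real_derivative - (ln (1 - v))\<^sup>2 / (2 * v)) (at v)"
    and "((\<lambda>v. logsq_primitive (1 / (1 + v)) - ln (1 + v) ^ 3 / 6)
           has_real_derivative - (ln (1 + v))\<^sup>2 / (2 * v)) (at v)"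
proof -
  have v2: "v\<^sup>2 < 1" "0 < v\<^sup>2"
    using assms by (auto simp: power_less_one_iff)
  have l: "ln (1 - v\<^sup>2) = ln (1 - v) + ln (1 + v)"
  proof -
    have "1 - v\<^sup>2 = (1 - v) * (1 + v)" by (simp add: algebra_simps power2_eq_square)
    thus ?thesis using assms by (simp add: ln_mult)
  qed
  show "((\<lambda>v. logsq_primitive (1 - v\<^sup>2))
           has_real_derivative - (ln (1 - v) + ln (1 + v))\<^sup>2 / v) (at v)"
    using v2 assms by (auto intro!: derivative_eq_intros simp: l)
       (simp add: divide_simps power2_eq_square)
  show "((\<lambda>v. logsq_primitive (1 - v)) has_real_derivative - (ln (1 - v))\<^sup>2 / (2 * v)) (at v)"
    using assms by (auto intro!: derivative_eq_intros)
  show "((\<lambda>v. logsq_primitive (1 / (1 + v)) - ln (1 + v) ^ 3 / 6)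
           has_real_derivative - (ln (1 + v))\<^sup>2 / (2 * v)) (at v)"
    using assms by (auto intro!: derivative_eq_intros simp: ln_div)
       (simp add: divide_simps power2_eq_square; simp add: algebra_simps)
  have u: "\<bar>(1 - v) / (1 + v)\<bar> < 1" "(1 - v) / (1 + v) \<noteq> 0"
          "\<bar>- ((1 - v) / (1 + v))\<bar> < 1" "- ((1 - v) / (1 + v)) \<noteq> 0"
    using assms by (auto simp: field_simps abs_if)
  have lu: "ln ((1 - v) / (1 + v)) = ln (1 - v) - ln (1 + v)"
    using assms by (simp add: ln_div)
  have u': "((\<lambda>v. (1 - v) / (1 + v)) has_real_derivative - 2 / (1 + v)\<^sup>2) (at v)"
    using assms by (auto intro!: derivative_eq_intros simp: power2_eq_square divide_simps)
  have eq: "1 - (1 - v) / (1 + v) = 2 * v / (1 + v)" "1 + (1 - v) / (1 + v) = 2 / (1 + v)"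
    using assms by (auto simp: field_simps)
  have d: "((\<lambda>v. logsq_primitive ((1 - v) / (1 + v))) has_real_derivative
             (ln ((1 - v) / (1 + v)))\<^sup>2 / (2 * (1 - (1 - v) / (1 + v))) * (- 2 / (1 + v)\<^sup>2)) (at v)"
          "((\<lambda>v. logsq_primitive (- ((1 - v) / (1 + v)))) has_real_derivative
             (ln (- ((1 - v) / (1 + v))))\<^sup>2 / (2 * (1 - - ((1 - v) / (1 + v))))
               * (- (- 2 / (1 + v)\<^sup>2))) (at v)"
    by (rule DERIV_chain2[OF has_real_derivative_logsq_primitive[OF u(1,2)] u'],
        rule DERIV_chain2[OF has_real_derivative_logsq_primitive[OF u(3,4)] DERIV_minus[OF u']])
  show "((\<lambda>v. logsq_primitive ((1 - v) / (1 + v)) - logsq_primitive (- ((1 - v) / (1 + v))))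
           has_real_derivative - (ln (1 - v) - ln (1 + v))\<^sup>2 / (2 * v)) (at v)"
    by (rule DERIV_cong[OF DERIV_diff[OF d]])
       (use assms in \<open>simp add: eq ln_minus lu, simp add: divide_simps power2_eq_square,
          simp add: algebra_simps\<close>)
qed

text \<open>The weights 1, 1/2, -2, -2 turn the four derivatives into the parallelogram identity. At
  0 the arguments are 1 and -1, so the constant is (1 + 3/4 + 1/2 - 2 - 2) L_3(1).\<close>

lemma logsq_primitive_kummer:
  assumes "0 < x" "x < 1"
  shows "logsq_primitive ((1 - x) / (1 + x)) - logsq_primitive (- ((1 - x) / (1 + x))) +
           logsq_primitive (1 - x\<^sup>2) / 2 - 2 * logsq_primitive (1 - x)
           - 2 * (logsq_primitive (1 / (1 + x)) - ln (1 + x) ^ 3 / 6) = - 7 / 4 * polylog 3 1"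
proof -
  let ?f = "\<lambda>x. (logsq_primitive ((1 - x) / (1 + x)) - logsq_primitive (- ((1 - x) / (1 + x)))) +
              logsq_primitive (1 - x\<^sup>2) / 2 - 2 * logsq_primitive (1 - x)
              - 2 * (logsq_primitive (1 / (1 + x)) - ln (1 + x) ^ 3 / 6)"
  have "?f x = ?f 0"
  proof (rule DERIV_isconst_end[OF assms(1)])
    show "continuous_on {0..x} ?f"
      by (intro continuous_intros continuous_on_logsq_primitive continuous_on_logsq_primitive_minus)
         (use assms in \<open>auto simp: field_simps power_less_one_iff power2_less_1_iff abs_square_less_1\<close>)
    show "(?f has_real_derivative 0) (at y)" if "0 < y" "y < x" for y
    proof -
      have y: "0 < y" "y < 1" using that assms by auto
      note d = logsq_primitive_compose_derivs[OF y]
      show ?thesis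
        by (rule DERIV_cong[OF DERIV_diff[OF DERIV_diff[OF DERIV_add[OF
              d(1) DERIV_cdivide[OF d(2)]] DERIV_cmult[OF d(3)]] DERIV_cmult[OF d(4)]]])
           (use y in \<open>simp add: field_simps power2_eq_square\<close>)
    qed
  qed
  thus ?thesis by (simp add: logsq_primitive_1 logsq_primitive_minus_1)
qed

section \<open>The double sum as a function of x\<close>

text \<open>This is the tail of the series of -ln(1 - x) from exponent n + 1 on. The closed form
  makes its derivative a finite computation: 1/(1 - x) minus a geometric sum.\<close>

definition log_tail :: "nat \<Rightarrow> real \<Rightarrow> real" where
  "log_tail n x = - ln (1 - x) - (\<Sum>j<n. x ^ Suc j / real (Suc j))"

lemma log_tail_sums:
  assumes "\<bar>x\<bar> < 1"
  shows "(\<lambda>i. x ^ (Suc n + i) / real (Suc n + i)) sums log_tail n x"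
proof -
  have "(\<lambda>i. x ^ Suc i / real (Suc i) ^ 1) sums polylog 1 x"
    using summable_sums[OF summable_power_over_power[OF assms, of 1]]
    by (subst sums_Suc_iff) (simp add: polylog_def)
  hence "(\<lambda>i. x ^ Suc i / real (Suc i)) sums - ln (1 - x)"
    using polylog_1[OF assms] by (simp del: of_nat_Suc)
  from sums_split_initial_segment[OF this, of n] show ?thesis
    by (simp add: log_tail_def add.commute)
qed

lemma has_real_derivative_log_tail:
  assumes "x < 1"
  shows "(log_tail n has_real_derivative x ^ n / (1 - x)) (at x within A)"
proof -
  have "(log_tail n has_real_derivative 1 / (1 - x) - (\<Sum>j<n. x ^ j)) (at x within A)"
    unfolding log_tail_def[abs_def]
    by (rule derivative_eq_intros refl | use assms in simp; fail)+
  also have "1 / (1 - x) - (\<Sum>j<n. x ^ j) = x ^ n / (1 - x)"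
    using assms by (simp add: sum_gp_strict diff_divide_distrib)
  finally show ?thesis .
qed

text \<open>It suffices that the differentiated series converges uniformly near \<open>x\<close> and
  the original one at a single point. That point is 0, where every \<open>log_tail n\<close>
  vanishes.\<close>

lemma log_tail_series:
  assumes "0 \<le> x" "x < 1"
  shows "summable (\<lambda>n. (-1) ^ n / real (Suc n) ^ 2 * log_tail n x)"
    and "((\<lambda>x. \<Sum>n. (-1) ^ n / real (Suc n) ^ 2 * log_tail n x)
           has_real_derivative (\<Sum>n. (-1) ^ n / real (Suc n) ^ 2 * (x ^ n / (1 - x)))) (at x)"
proof -
  \<comment> \<open>Staying below \<open>r < 1\<close> bounds 1/(1 - y) uniformly; the symmetric
    interval contains both 0 and \<open>x\<close> in its interior.\<close>
  obtain r where r: "x < r" "r < 1" using assms(2) dense by blast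
  let ?S = "{-r<..<r}"
  have conv: "uniformly_convergent_on ?S
          (\<lambda>N x. \<Sum>n<N. (-1) ^ n / real (Suc n) ^ 2 * (x ^ n / (1 - x)))"
  proof (rule Weierstrass_m_test'_ev[OF always_eventually])
    show "\<forall>n. \<forall>y\<in>?S. norm ((-1) ^ n / real (Suc n) ^ 2 * (y ^ n / (1 - y)))
             \<le> 1 / real (Suc n) ^ 2 * (1 / (1 - r))"
    proof (intro allI ballI)
      fix n y assume y: "y \<in> ?S"
      hence "\<bar>y\<bar> ^ n / (1 - y) \<le> 1 / (1 - r)"
        using r by (intro frac_le power_le_one) auto
      hence "1 / real (Suc n) ^ 2 * (\<bar>y\<bar> ^ n / (1 - y)) \<le> 1 / real (Suc n) ^ 2 * (1 / (1 - r))"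
        by (intro mult_left_mono) auto
      thus "norm ((-1) ^ n / real (Suc n) ^ 2 * (y ^ n / (1 - y)))
             \<le> 1 / real (Suc n) ^ 2 * (1 / (1 - r))"
        using y r by (simp add: abs_mult power_abs)
    qed
    have "summable (\<lambda>n. 1 / real (Suc n) ^ 2)"
      using summable_polylog[of 2 1] by (subst summable_Suc_iff) simp
    thus "summable (\<lambda>n. 1 / real (Suc n) ^ 2 * (1 / (1 - r)))"
      by (rule summable_mult2)
  qed
  have 0: "0 \<in> ?S" "x \<in> interior ?S" using assms r by auto
  have 1: "summable (\<lambda>n. (-1) ^ n / real (Suc n) ^ 2 * log_tail n 0)"
    by (simp add: log_tail_def)
  have 2: "((\<lambda>x. (-1) ^ n / real (Suc n) ^ 2 * log_tail n x) has_real_derivative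
          (-1) ^ n / real (Suc n) ^ 2 * (y ^ n / (1 - y))) (at y within ?S)" if "y \<in> ?S" for n y
    by (intro DERIV_cmult has_real_derivative_log_tail) (use that r in auto)
  show "summable (\<lambda>n. (-1) ^ n / real (Suc n) ^ 2 * log_tail n x)"
    and "((\<lambda>x. \<Sum>n. (-1) ^ n / real (Suc n) ^ 2 * log_tail n x)
           has_real_derivative (\<Sum>n. (-1) ^ n / real (Suc n) ^ 2 * (x ^ n / (1 - x)))) (at x)"
    using has_field_derivative_series'[OF _ 2 conv 0(1) 1 0(2)] by auto
qed

lemma log_tail_series_deriv_eq:
  assumes "0 < x" "x < 1"
  shows "(\<Sum>n. (-1) ^ n / real (Suc n) ^ 2 * (x ^ n / (1 - x))) = - polylog 2 (- x) / (x * (1 - x))"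
proof -
  have "(\<lambda>n. (- x) ^ Suc n / real (Suc n) ^ 2) sums polylog 2 (- x)"
    using summable_sums[OF summable_polylog[of 2 "- x"]] assms
    by (subst sums_Suc_iff) (simp add: polylog_def)
  from sums_mult2[OF this, of "- 1 / (x * (1 - x))"]
  have "(\<lambda>n. (- x) ^ Suc n / real (Suc n) ^ 2 * (- 1 / (x * (1 - x))))
          sums (- polylog 2 (- x) / (x * (1 - x)))" by simp
  also have "(\<lambda>n. (- x) ^ Suc n / real (Suc n) ^ 2 * (- 1 / (x * (1 - x)))) =
               (\<lambda>n. (-1) ^ n / real (Suc n) ^ 2 * (x ^ n / (1 - x)))"
    using assms by (auto simp: fun_eq_iff divide_simps power_minus[of x] simp del: of_nat_Suc)
  finally show ?thesis by (simp add: sums_iff)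
qed

text \<open>As 1/(y (1 - y)) = 1/y + 1/(1 - y), the first two terms on the right absorb the
  dilogarithms and leave ln(1 - y) ln(1 + y)/y. Polarization writes this by the primitives of (a +
  b)^2 and (a - b)^2. The value at 0 gives the constant 1/4 - (1 + 3/4)/2 = -5/8.\<close>

lemma log_tail_series_eq:
  assumes "0 < x" "x < 1"
  shows "(\<Sum>n. (-1) ^ n / real (Suc n) ^ 2 * log_tail n x) =
           - polylog 3 (- x) + ln (1 - x) * polylog 2 (- x) - logsq_primitive (1 - x\<^sup>2) / 4
           + (logsq_primitive ((1 - x) / (1 + x)) - logsq_primitive (- ((1 - x) / (1 + x)))) / 2
           - 5 / 8 * polylog 3 1"
proof -
  let ?F = "\<lambda>x. (\<Sum>n. (-1) ^ n / real (Suc n) ^ 2 * log_tail n x)"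
  let ?f = "\<lambda>x. ?F x + polylog 3 (- x) - ln (1 - x) * polylog 2 (- x) + logsq_primitive (1 - x\<^sup>2) / 4
           - (logsq_primitive ((1 - x) / (1 + x)) - logsq_primitive (- ((1 - x) / (1 + x)))) / 2"
  have "?f x = ?f 0"
  proof (rule DERIV_isconst_end[OF assms(1)])
    have "continuous_on {0..x} ?F"
      by (rule DERIV_continuous_on[OF has_field_derivative_at_within[OF log_tail_series(2)]])
         (use assms in auto)
    thus "continuous_on {0..x} ?f"
      by (intro continuous_intros continuous_on_logsq_primitive continuous_on_logsq_primitive_minus)
         (use assms in \<open>auto simp: field_simps abs_square_less_1\<close>)
    show "(?f has_real_derivative 0) (at y)" if y: "0 < y" "y < x" for y
    proof -
      have F: "(?F has_real_derivative - polylog 2 (- y) / (y * (1 - y))) (at y)"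
        using log_tail_series(2)[of y] log_tail_series_deriv_eq[of y] y assms by simp
      have y': "0 < y" "y < 1" using y assms by auto
      note d = logsq_primitive_compose_derivs[OF y']
      have e: "((\<lambda>x. polylog 3 (- x)) has_real_derivative polylog 2 (- y) / y) (at y)"
              "((\<lambda>x. ln (1 - x) * polylog 2 (- x)) has_real_derivative
                 - polylog 2 (- y) / (1 - y) - ln (1 - y) * ln (1 + y) / y) (at y)"
        using y' by (auto intro!: derivative_eq_intros)
      show ?thesis
        by (rule DERIV_cong[OF DERIV_diff[OF DERIV_add[OF DERIV_diff[OF DERIV_add[OF
              F e(1)] e(2)] DERIV_cdivide[OF d(2)]] DERIV_cdivide[OF d(1)]]])
           (use y' in \<open>simp add: divide_simps power2_eq_square; simp add: algebra_simps\<close>)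
    qed
  qed
  thus ?thesis by (simp add: logsq_primitive_1 logsq_primitive_minus_1 log_tail_def)
qed

section \<open>Evaluation at x = 1/2\<close>

lemma zeta_3: "zeta 3 = polylog 3 1"
proof -
  have "(\<lambda>n. 1 ^ Suc n / real (Suc n) ^ 3) sums polylog 3 1"
    using summable_sums[OF summable_polylog[of 3 1]]
    by (subst sums_Suc_iff) (simp add: polylog_def)
  thus ?thesis by (simp add: zeta_def sums_iff powr_numeral del: of_nat_Suc)
qed

lemma log_tail_series_half:
  "(\<Sum>n. (-1) ^ n / real (Suc n) ^ 2 * log_tail n (1 / 2)) = 13 / 24 * polylog 3 1"
proof -
  have ln: "ln (1 / 2 :: real) = - ln 2" "ln (1 / 3 :: real) = - ln 3"
      "ln (2 / 3 :: real) = ln 2 - ln 3" "ln (3 / 2 :: real) = ln 3 - ln 2"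
      "ln (4 / 3 :: real) = 2 * ln 2 - ln 3"
      "ln (3 / 4 :: real) = ln 3 - 2 * ln 2" "ln (1 / 4 :: real) = - 2 * ln 2"
    using ln_realpow[of 2 2] by (simp_all add: ln_div)
  \<comment> \<open>Together with \<open>l\<close> and \<open>d\<close>, this reduces every
    dilogarithm that occurs to L_2(1), L_2(1/3) and logarithms of 2 and 3.\<close>
  have r: "polylog 2 (1 / 2) = polylog 2 1 / 2 - (ln 2)\<^sup>2 / 2"
      "polylog 2 (2 / 3) = polylog 2 1 - polylog 2 (1 / 3) - ln (2 / 3) * ln (1 / 3)"
      "polylog 2 (3 / 4) = polylog 2 1 - polylog 2 (1 / 4) - ln (3 / 4) * ln (1 / 4)"
    using dilog_reflection[of "1 / 2"] dilog_reflection[of "2 / 3"] dilog_reflection[of "3 / 4"]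
    by (simp_all add: ln power2_eq_square)
  have l: "polylog 2 (- (1 / 2)) = - (ln (2 / 3))\<^sup>2 / 2 - polylog 2 (1 / 3)"
      "polylog 2 (- (1 / 3)) = - (ln (3 / 4))\<^sup>2 / 2 - polylog 2 (1 / 4)"
    using dilog_landen[of "2 / 3"] dilog_landen[of "3 / 4"] by simp_all
  have d: "polylog 2 (1 / 4) = 2 * (polylog 2 (1 / 2) + polylog 2 (- (1 / 2)))"
      "polylog 3 (1 / 4) = 4 * (polylog 3 (1 / 2) + polylog 3 (- (1 / 2)))"
    using polylog_square[of 2 "1 / 2"] polylog_square[of 3 "1 / 2"] by (simp_all add: power2_eq_square)
  note t = trilog_landen[of "1 / 2"] trilog_landen[of "2 / 3"] trilog_landen[of "3 / 4"]
  note k = logsq_primitive_kummer[of "1 / 2"]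
  have h: "0 < (1 / 2 :: real)" "(1 / 2 :: real) < 1" by simp_all
  \<comment> \<open>Modulo products of lower weight, Landen and duplication turn the sum into
    L_3(1/3)/2 - L_3(-1/3)/4, and Kummer's identity into 3 L_3(1/3) - 3/2 L_3(-1/3) = 13/4 L_3(1).
    The former is one sixth of the latter, hence 13/24; the lower terms cancel.\<close>
  show ?thesis
    unfolding log_tail_series_eq[OF h]
    by (insert t k,
        simp add: logsq_primitive_def ln_minus power2_eq_square,
        simp add: ln r l d polylog_minus_1,
        simp add: ln power2_eq_square power3_eq_cube algebra_simps
          add_divide_distrib diff_divide_distrib)
qed

theorem theorem1p3:
  "(\<forall>k\<ge>1. summable (\<lambda>i. summand k (k + i))) \<and>
   (\<lambda>n. \<Sum>i. summand (Suc n) (Suc n + i)) sums (13 / 24 * zeta 3)"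
proof -
  \<comment> \<open>Here k = n + 1, so exactly \<open>n\<close> initial terms of the logarithmic
    series are cut off.\<close>
  have inner: "(\<lambda>i. summand (Suc n) (Suc n + i)) sums
                 ((-1) ^ n / real (Suc n) ^ 2 * log_tail n (1 / 2))" for n
  proof -
    have "(\<lambda>i. summand (Suc n) (Suc n + i)) =
            (\<lambda>i. (-1) ^ n / real (Suc n) ^ 2 * ((1 / 2) ^ (Suc n + i) / real (Suc n + i)))"
      by (simp add: summand_def fun_eq_iff field_simps)
    thus ?thesis
      using sums_mult[OF log_tail_sums[of "1 / 2" n]] by (simp only:)
  qed
  have "summable (\<lambda>i. summand k (k + i))" if "k \<ge> 1" for k
    using sums_summable[OF inner[of "k - 1"]] that by simp
  moreover have "(\<lambda>n. \<Sum>i. summand (Suc n) (Suc n + i)) =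
                   (\<lambda>n. (-1) ^ n / real (Suc n) ^ 2 * log_tail n (1 / 2))"
    using inner by (simp add: sums_iff)
  ultimately show ?thesis
    using summable_sums[OF log_tail_series(1)[of "1 / 2"]]
    unfolding log_tail_series_half zeta_3 by simp
qed

end
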